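(* Let $(x_n,f_n)_{n=1}^\infty$ be a Schauder frame of a Banach space $X$ with $x_n\ne0$ for all $n$, and let $K$ be its projection constant. Let $\{y_n\}_{n=1}^\infty$ be a sequence in $X$ which satisfies $\lambda:=\sum_{n=1}^\infty\frac{\|x_n-y_n\|}{\|x_n\|}<\frac{1}{K}$. Then there exists a sequence $\{g_n\}_{n=1}^\infty$ in $X^*$ such that $(y_n,g_n)_{n=1}^\infty$ is a Schauder frame of $X$. Moreover, $Z_{Min}$ (the minimal space with respect to $(x_n,f_n)_{n=1}^\infty$, with its minimal basis $\{e_n^{Min}\}_{n=1}^\infty$) is a sequence space associated to $(y_n,g_n)_{n=1}^\infty$; namely, the operator $U:Z_{Min}\to X$, $U\left(\sum_{n=1}^\infty c_ne_n^{Min}\right)=\sum_{n=1}^\infty c_ny_n$, is well defined and bounded with $\|U\|\le1+\lambda$, and $V:X\to Z_{Min}$, $V(x)=\sum_{n=1}^\infty g_n(x)e_n^{Min}$, is also a (well-defined) bounded operator, which satisfies $$\frac{1}{1+\lambda}\|x\|\le\|V(x)\|\le\frac{K}{1-\lambda K}\|x\|\qquad\text{for all }x\in X.$$ In addition, if $(x_n,f_n)_{n=1}^\infty$ is an unconditional Schauder frame, then $(y_n,g_n)_{n=1}^\infty$ is also an unconditional Schauder frame.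
   Context: Let $X$ be a separable Banach space. A sequence $(x_n,f_n)_{n=1}^\infty$ with $x_n\in X$, $f_n\in X^*$ is a Schauder frame of $X$ if $x=\sum_{n=1}^\infty f_n(x)x_n$ (norm convergence) for every $x\in X$; it is an unconditional Schauder frame if this series converges unconditionally for every $x\in X$. The projection constant of a Schauder frame $(x_n,f_n)_{n=1}^\infty$ is $K:=\sup_{x\in B_X}\sup_{m\le n}\left\|\sum_{i=m}^nf_i(x)x_i\right\|<\infty$, where $B_X$ is the unit ball of $X$. For a Schauder frame $(x_n,f_n)_{n=1}^\infty$ with all $x_n\ne0$, define on $c_{00}$ (finitely supported scalar sequences, with unit vectors $e_i$) the norm $\left\|\sum_ic_ie_i\right\|_{Min}=\max_{m\le n}\left\|\sum_{i=m}^nc_ix_i\right\|$. The minimal space $Z_{Min}$ with respect to $(x_n,f_n)_{n=1}^\infty$ is the completion of $(c_{00},\|\cdot\|_{Min})$. The unit vectors, denoted $\{e_n^{Min}\}_{n=1}^\infty$, form a (bi-monotone Schauder) basis of $Z_{Min}$, called the minimal basis. A Banach space $Z$ with a Schauder basis $\{z_n\}_{n=1}^\infty$ is a sequence space associated to a Schauder frame $(y_n,g_n)_{n=1}^\infty$ of $X$ if $Z\to X$, $\sum c_nz_n\mapsto\sum c_ny_n$, and $X\to Z$, $x\mapsto\sum g_n(x)z_n$, are (well-defined) bounded operators. *)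

theory Defs
  imports "HOL-Analysis.Analysis"
begin

text \<open>Sequences are indexed from 0. The dual of \<open>X\<close> is \<open>'a \<Rightarrow>\<^sub>L real\<close>.\<close>

definition schauder_frame ::
    "(nat \<Rightarrow> 'a::banach) \<Rightarrow> (nat \<Rightarrow> 'a \<Rightarrow>\<^sub>L real) \<Rightarrow> bool" where
  "schauder_frame x f \<longleftrightarrow> (\<forall>v. (\<lambda>n. blinfun_apply (f n) v *\<^sub>R x n) sums v)"

definition unconditionally_convergent :: "(nat \<Rightarrow> 'a::real_normed_vector) \<Rightarrow> bool" where
  "unconditionally_convergent a \<longleftrightarrow> (\<forall>p::nat \<Rightarrow> nat. bij p \<longrightarrow> summable (\<lambda>n. a (p n)))"

definition unconditional_schauder_frame ::
    "(nat \<Rightarrow> 'a::banach) \<Rightarrow> (nat \<Rightarrow> 'a \<Rightarrow>\<^sub>L real) \<Rightarrow> bool" where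
  "unconditional_schauder_frame x f \<longleftrightarrow> schauder_frame x f \<and>
     (\<forall>v. unconditionally_convergent (\<lambda>n. blinfun_apply (f n) v *\<^sub>R x n))"

text \<open>For a Schauder frame the set below is bounded, by the uniform boundedness principle, so that
  the real supremum is the actual one.\<close>

definition projection_const ::
    "(nat \<Rightarrow> 'a::banach) \<Rightarrow> (nat \<Rightarrow> 'a \<Rightarrow>\<^sub>L real) \<Rightarrow> real" where
  "projection_const x f =
     Sup {norm (\<Sum>i=m..n. blinfun_apply (f i) v *\<^sub>R x i) | v m n. norm v \<le> 1 \<and> m \<le> n}"

definition c00 :: "(nat \<Rightarrow> real) set" where
  "c00 = {c. finite {i. c i \<noteq> 0}}"

definition unit_vec :: "nat \<Rightarrow> nat \<Rightarrow> real" where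
  "unit_vec n = (\<lambda>i. if i = n then 1 else 0)"

text \<open>For \<open>c \<in> c00\<close> the set below is finite, see \<open>finite_segment_norms\<close>.\<close>

definition min_norm :: "(nat \<Rightarrow> 'a::real_normed_vector) \<Rightarrow> (nat \<Rightarrow> real) \<Rightarrow> real" where
  "min_norm x c = Max {norm (\<Sum>i=m..n. c i *\<^sub>R x i) | m n. m \<le> n}"

text \<open>
  Completion of \<open>c00\<close> under \<open>min_norm x\<close>: the map \<open>min_embed x\<close> sends \<open>c\<close> to the family of all its
  segment sums, which is a linear isometric embedding of \<open>c00\<close> into the Banach space of bounded
  functions from \<open>nat \<times> nat\<close> to \<open>'a\<close> with the supremum norm (the topology of \<open>nat \<times> nat\<close> is
  discrete, so every function is continuous). The completion is realised as the closure of the image.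
\<close>

type_synonym 'a segment_space = "(nat \<times> nat) \<Rightarrow>\<^sub>C 'a"

definition min_embed :: "(nat \<Rightarrow> 'a::banach) \<Rightarrow> (nat \<Rightarrow> real) \<Rightarrow> 'a segment_space" where
  "min_embed x c = Bcontfun (\<lambda>(m, n). \<Sum>i=m..n. c i *\<^sub>R x i)"

definition Z_Min :: "(nat \<Rightarrow> 'a::banach) \<Rightarrow> 'a segment_space set" where
  "Z_Min x = closure (min_embed x ` c00)"

definition e_Min :: "(nat \<Rightarrow> 'a::banach) \<Rightarrow> nat \<Rightarrow> 'a segment_space" where
  "e_Min x n = min_embed x (unit_vec n)"

lemma finite_segment_norms:
  assumes "c \<in> c00"
  shows "finite (range (\<lambda>(m, n). norm (\<Sum>i=m..n. c i *\<^sub>R x i)))"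
proof -
  let ?S = "{i. c i \<noteq> 0}"
  have "(\<Sum>i=m..n. c i *\<^sub>R x i) = (\<Sum>i\<in>{m..n} \<inter> ?S. c i *\<^sub>R x i)" for m n
    by (rule sum.mono_neutral_right) auto
  then have "range (\<lambda>(m, n). norm (\<Sum>i=m..n. c i *\<^sub>R x i))
      \<subseteq> (\<lambda>A. norm (\<Sum>i\<in>A. c i *\<^sub>R x i)) ` Pow ?S"
    by auto
  moreover have "finite (Pow ?S)"
    using assms by (simp add: c00_def)
  ultimately show ?thesis
    by (meson finite_imageI finite_subset)
qed

lemma apply_min_embed:
  assumes "c \<in> c00"
  shows "apply_bcontfun (min_embed x c) (m, n) = (\<Sum>i=m..n. c i *\<^sub>R x i)"
proof -
  let ?h = "\<lambda>(m, n). \<Sum>i=m..n. c i *\<^sub>R x i"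
  have "open {p}" for p :: "nat \<times> nat"
  proof -
    have "open ({fst p} \<times> {snd p})" by (intro open_Times open_discrete)
    then show ?thesis by simp
  qed
  then have "open S" for S :: "(nat \<times> nat) set"
    by (metis open_subopen insert_subset empty_subsetI singletonI)
  then have "continuous_on UNIV ?h"
    by (simp add: continuous_on_open_vimage)
  moreover have "bounded (range ?h)"
  proof -
    obtain B where "\<forall>r\<in>range (\<lambda>(m, n). norm (\<Sum>i=m..n. c i *\<^sub>R x i)). r \<le> B"
      using finite_segment_norms[OF assms, THEN bdd_above_finite] unfolding bdd_above_def by blast
    then show ?thesis
      by (auto intro!: boundedI[where B=B])
  qed
  ultimately show ?thesis
    by (simp add: min_embed_def Bcontfun_inverse bcontfun_def)
qed

lemma norm_min_embed:
  assumes "c \<in> c00"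
  shows "norm (min_embed x c) = min_norm x c"
proof (rule antisym)
  let ?N = "{norm (\<Sum>i=m..n. c i *\<^sub>R x i) | m n. m \<le> n}"
  have fin: "finite ?N"
    by (rule finite_subset[OF _ finite_segment_norms[OF assms, of x]]) auto
  have ge: "norm (\<Sum>i=m..n. c i *\<^sub>R x i) \<le> Max ?N" if "m \<le> n" for m n
    using that by (intro Max_ge[OF fin]) auto
  have "norm (\<Sum>i=m..n. c i *\<^sub>R x i) \<le> Max ?N" for m n
    using ge[of m n] order_trans[OF norm_ge_zero ge[of 0 0]] by (cases "m \<le> n") auto
  then show "norm (min_embed x c) \<le> min_norm x c"
    unfolding min_norm_def
    by (intro norm_bound) (auto simp: apply_min_embed[OF assms])
  have "norm (\<Sum>i=m..n. c i *\<^sub>R x i) \<le> norm (min_embed x c)" for m n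
    using norm_bounded[of "min_embed x c" "(m, n)"] by (simp add: apply_min_embed[OF assms])
  moreover have "?N \<noteq> {}" by auto
  ultimately show "min_norm x c \<le> norm (min_embed x c)"
    unfolding min_norm_def using fin by (subst Max_le_iff) auto
qed

lemma min_embed_linear:
  assumes "c \<in> c00" "d \<in> c00"
  shows "min_embed x (\<lambda>i. a * c i + b * d i) = a *\<^sub>R min_embed x c + b *\<^sub>R min_embed x d"
proof -
  have "{i. a * c i + b * d i \<noteq> 0} \<subseteq> {i. c i \<noteq> 0} \<union> {i. d i \<noteq> 0}" by auto
  then have "(\<lambda>i. a * c i + b * d i) \<in> c00"
    using assms unfolding c00_def by (auto intro: finite_subset)
  then show ?thesis
    by (intro bcontfun_eqI)
       (auto simp: apply_min_embed assms scaleR_add_left sum.distrib scaleR_sum_right)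
qed

lemma subspace_Z_Min: "subspace (Z_Min x)"
proof (rule subspaceI)
  have z: "(\<lambda>i. 0) \<in> c00" by (simp add: c00_def)
  have "0 = min_embed x (\<lambda>i. 0)"
    by (intro bcontfun_eqI) (auto simp: apply_min_embed[OF z])
  then show "0 \<in> Z_Min x"
    using z unfolding Z_Min_def by (simp add: closure_subset[THEN subsetD])
  have step: "a *\<^sub>R v + b *\<^sub>R w \<in> min_embed x ` c00"
    if vw: "v \<in> min_embed x ` c00" "w \<in> min_embed x ` c00" for v w a b
  proof -
    obtain c d where cd: "c \<in> c00" "d \<in> c00" "v = min_embed x c" "w = min_embed x d"
      using vw by blast
    have "{i. a * c i + b * d i \<noteq> 0} \<subseteq> {i. c i \<noteq> 0} \<union> {i. d i \<noteq> 0}" by auto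
    then have "(\<lambda>i. a * c i + b * d i) \<in> c00"
      using cd unfolding c00_def by (auto intro: finite_subset)
    then show ?thesis
      unfolding cd(3,4) min_embed_linear[OF cd(1,2), symmetric] by (rule imageI)
  qed
  have comb: "a *\<^sub>R v + b *\<^sub>R w \<in> Z_Min x" if vw: "v \<in> Z_Min x" "w \<in> Z_Min x" for v w a b
  proof -
    obtain p where p: "\<And>n. p n \<in> min_embed x ` c00" "p \<longlonglongrightarrow> v"
      using vw(1) unfolding Z_Min_def closure_sequential by blast
    obtain q where q: "\<And>n. q n \<in> min_embed x ` c00" "q \<longlonglongrightarrow> w"
      using vw(2) unfolding Z_Min_def closure_sequential by blast
    have "\<forall>n. a *\<^sub>R p n + b *\<^sub>R q n \<in> min_embed x ` c00"
      using step[OF p(1) q(1)] by simp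
    moreover have "(\<lambda>n. a *\<^sub>R p n + b *\<^sub>R q n) \<longlonglongrightarrow> a *\<^sub>R v + b *\<^sub>R w"
      by (intro tendsto_add tendsto_scaleR tendsto_const p q)
    ultimately show ?thesis
      unfolding Z_Min_def closure_sequential
      by (intro exI[of _ "\<lambda>n. a *\<^sub>R p n + b *\<^sub>R q n"] conjI)
  qed
  show "v + w \<in> Z_Min x" if "v \<in> Z_Min x" "w \<in> Z_Min x" for v w
    using comb[OF that, of 1 1] by simp
  show "a *\<^sub>R v \<in> Z_Min x" if "v \<in> Z_Min x" for a v
    using comb[OF that that, of a 0] by simp
qed

text \<open>The library has completeness of this function space only over metric domains, and \<open>nat \<times> nat\<close>
  is not of class \<open>metric_space\<close>.\<close>

lemma complete_Z_Min: "complete (Z_Min x)"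
  unfolding complete_def
proof (intro allI impI)
  fix h :: "nat \<Rightarrow> 'a segment_space"
  assume h: "(\<forall>n. h n \<in> Z_Min x) \<and> Cauchy h"
  then obtain l where "uniform_limit UNIV h l sequentially"
    using uniformly_convergent_eq_cauchy[of "\<lambda>_. True" h]
    unfolding Cauchy_def uniform_limit_sequentially_iff
    by (metis dist_fun_lt_imp_dist_val_lt)
  from uniform_limit_bcontfunE[OF this sequentially_bot]
  obtain l' where l': "h \<longlonglongrightarrow> l'" by metis
  moreover have "l' \<in> Z_Min x"
    using h l' closed_sequentially[of "Z_Min x" h l'] by (simp add: Z_Min_def)
  ultimately show "\<exists>l\<in>Z_Min x. h \<longlonglongrightarrow> l" by blast
qed

text \<open>
  Schauder bases, operators and operator norms for a Banach space given as a complete subspace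
  \<open>Z\<close> of an ambient normed space; \<open>onorm_on UNIV\<close> is \<open>onorm\<close>.
\<close>

definition schauder_basis_on :: "'z::real_normed_vector set \<Rightarrow> (nat \<Rightarrow> 'z) \<Rightarrow> bool" where
  "schauder_basis_on Z z \<longleftrightarrow> subspace Z \<and> complete Z \<and> range z \<subseteq> Z \<and>
     (\<forall>w\<in>Z. \<exists>!c::nat \<Rightarrow> real. (\<lambda>n. c n *\<^sub>R z n) sums w)"

definition bounded_linear_on ::
    "'z::real_normed_vector set \<Rightarrow> ('z \<Rightarrow> 'a::real_normed_vector) \<Rightarrow> bool" where
  "bounded_linear_on Z U \<longleftrightarrow>
     (\<forall>v\<in>Z. \<forall>w\<in>Z. U (v + w) = U v + U w) \<and>
     (\<forall>r. \<forall>v\<in>Z. U (r *\<^sub>R v) = r *\<^sub>R U v) \<and>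
     (\<exists>B. \<forall>v\<in>Z. norm (U v) \<le> B * norm v)"

definition onorm_on ::
    "'z::real_normed_vector set \<Rightarrow> ('z \<Rightarrow> 'a::real_normed_vector) \<Rightarrow> real" where
  "onorm_on Z U = (SUP v\<in>Z. norm (U v) / norm v)"

text \<open>The operator \<open>\<Sum> c\<^sub>n z\<^sub>n \<mapsto> \<Sum> c\<^sub>n y\<^sub>n\<close> from \<open>Z\<close> to \<open>X\<close>, well defined and bounded.\<close>

definition synthesis_operator ::
    "'z::real_normed_vector set \<Rightarrow> (nat \<Rightarrow> 'z) \<Rightarrow> (nat \<Rightarrow> 'a::banach) \<Rightarrow> ('z \<Rightarrow> 'a) \<Rightarrow> bool" where
  "synthesis_operator Z z y U \<longleftrightarrow> bounded_linear_on Z U \<and>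
     (\<forall>c::nat \<Rightarrow> real. \<forall>w\<in>Z. (\<lambda>n. c n *\<^sub>R z n) sums w \<longrightarrow> (\<lambda>n. c n *\<^sub>R y n) sums U w)"

text \<open>The operator \<open>v \<mapsto> \<Sum> g\<^sub>n(v) z\<^sub>n\<close> from \<open>X\<close> to \<open>Z\<close>, well defined and bounded.\<close>

definition analysis_operator ::
    "'z::real_normed_vector set \<Rightarrow> (nat \<Rightarrow> 'z) \<Rightarrow> (nat \<Rightarrow> 'a::banach \<Rightarrow>\<^sub>L real) \<Rightarrow> ('a \<Rightarrow> 'z) \<Rightarrow> bool" where
  "analysis_operator Z z g V \<longleftrightarrow> bounded_linear V \<and> range V \<subseteq> Z \<and>
     (\<forall>v. (\<lambda>n. blinfun_apply (g n) v *\<^sub>R z n) sums V v)"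

definition associated_sequence_space ::
    "'z::real_normed_vector set \<Rightarrow> (nat \<Rightarrow> 'z) \<Rightarrow> (nat \<Rightarrow> 'a::banach) \<Rightarrow> (nat \<Rightarrow> 'a \<Rightarrow>\<^sub>L real) \<Rightarrow> bool" where
  "associated_sequence_space Z z y g \<longleftrightarrow> schauder_basis_on Z z \<and> schauder_frame y g \<and>
     (\<exists>U. synthesis_operator Z z y U) \<and> (\<exists>V. analysis_operator Z z g V)"

end

theory Submission
  imports Defs
begin

text \<open>
  Put \<open>R v = \<Sum> f\<^sub>n(v) (y\<^sub>n - x\<^sub>n)\<close>. Since \<open>\<bar>f\<^sub>n(v)\<bar> \<parallel>x\<^sub>n\<parallel> \<le> K \<parallel>v\<parallel>\<close>, the series converges absolutely and
  \<open>\<parallel>R\<parallel> \<le> \<lambda>K < 1\<close>, so \<open>I + R\<close> has a bounded right inverse \<open>S\<close>, and \<open>g\<^sub>n = f\<^sub>n \<circ> S\<close> works because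
  \<open>\<Sum> f\<^sub>n(S v) y\<^sub>n = (I + R)(S v) = v\<close>. The norm of \<open>V\<close> is read off from the segment sums of
  \<open>\<Sum> f\<^sub>n(S v) x\<^sub>n\<close>, that of \<open>U\<close> from \<open>\<bar>c\<^sub>n\<bar> \<parallel>x\<^sub>n\<parallel> \<le> \<parallel>\<Sum> c\<^sub>i e\<^sub>i\<parallel>\<close>, and \<open>U V = I\<close> gives the lower bound
  for \<open>V\<close>. The two frame series differ by an absolutely convergent one, so unconditional
  convergence carries over.
\<close>

section \<open>Uniform boundedness and the projection constant\<close>

text \<open>By Baire's theorem one of the closed sets \<open>A n\<close> covering the space contains
  a ball, say around \<open>a\<close>. Writing \<open>v\<close> as \<open>(a + v) - a\<close> moves
  the ball to the origin at the cost of a factor 2, and scaling does the rest.\<close>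

theorem uniform_boundedness:
  fixes S :: "'i \<Rightarrow> 'a::banach \<Rightarrow> 'b::real_normed_vector"
  assumes lin: "\<And>i. bounded_linear (S i)"
    and bdd: "\<And>v. \<exists>B. \<forall>i. norm (S i v) \<le> B"
  shows "\<exists>C. \<forall>i v. norm (S i v) \<le> C * norm v"
proof -
  define A where "A n = {v. \<forall>i. norm (S i v) \<le> real n}" for n
  have "closed {v. norm (S i v) \<le> real n}" for i n
    by (intro closed_Collect_le continuous_intros linear_continuous_on[OF lin]) 
  then have closed: "closed (A n)" for n
    unfolding A_def Collect_all_eq by (intro closed_INT) auto
  have "\<Union>(range A) = UNIV"
  proof -
    have "\<exists>n. v \<in> A n" for v
    proof -
      obtain B where "\<forall>i. norm (S i v) \<le> B" using bdd by blast
      moreover obtain n where "B \<le> real n" using real_arch_simple by blast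
      ultimately show ?thesis unfolding A_def using order_trans by blast
    qed
    then show ?thesis by auto
  qed
  then have "\<not> (\<forall>T\<in>range A. interior T = {})"
    using Baire_category_alt[of "euclidean :: 'a topology" "range A"] closed
    by (fastforce simp: completely_metrizable_space_euclidean)
  then obtain n where "interior (A n) \<noteq> {}" by blast
  then obtain a e where e: "e > 0" "cball a e \<subseteq> A n"
    by (metis all_not_in_conv mem_interior_cball)
  have small: "norm (S i v) \<le> 2 * real n" if "norm v \<le> e" for i v
  proof -
    have "a + v \<in> A n" "a \<in> A n"
      using that e by (auto intro!: subsetD[OF e(2)] simp: dist_norm)
    then have "norm (S i (a + v)) \<le> n" "norm (S i a) \<le> n" by (auto simp: A_def)
    moreover have "S i v = S i (a + v) - S i a"
      using lin by (simp add: bounded_linear.linear linear_add)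
    ultimately show ?thesis by (metis norm_triangle_le_diff add_mono mult_2)
  qed
  have "norm (S i v) \<le> 2 * real n / e * norm v" for i v
  proof (cases "v = 0")
    case True
    then show ?thesis using lin by (simp add: bounded_linear.linear linear_0)
  next
    case False
    have "norm (S i ((e / norm v) *\<^sub>R v)) \<le> 2 * real n"
      by (rule small) (use False e in auto)
    then have "e / norm v * norm (S i v) \<le> 2 * real n"
      using lin e by (simp add: bounded_linear.linear linear_scale)
    then show ?thesis using False e by (simp add: field_simps)
  qed
  then show ?thesis by blast
qed

lemma summable_segments_bounded:
  fixes a :: "nat \<Rightarrow> 'a::real_normed_vector"
  assumes "summable a"
  shows "\<exists>B. \<forall>m n. norm (sum a {m..n}) \<le> B"
proof -
  obtain B where B: "\<And>n. norm (sum a {..<n}) \<le> B" "B > 0"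
    using assms unfolding summable_iff_convergent by (metis Bseq_def convergent_imp_Bseq)
  have "norm (sum a {m..n}) \<le> 2 * B" for m n
  proof (cases "m \<le> n")
    case True
    have "sum a {m..n} = sum a {..<Suc n} - sum a {..<m}"
      using sum_diff_nat_ivl[of 0 m "Suc n" a] True
      by (simp only: atLeastLessThanSuc_atLeastAtMost lessThan_Suc_atMost atLeast0AtMost
          atLeast0LessThan le_SucI zero_le)
    then show ?thesis
      using norm_triangle_ineq4[of "sum a {..<Suc n}" "sum a {..<m}"] B(1)[of "Suc n"] B(1)[of m]
      by simp
  qed (use B in simp)
  then show ?thesis by blast
qed

text \<open>Convergence at each vector bounds the segment sums pointwise, hence uniformly on the
  unit ball. So the \<open>Sup\<close> in \<open>projection_const\<close> is over a bounded set and
  is a genuine upper bound; homogeneity extends it to all vectors.\<close>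

lemma schauder_frame_segment_bound:
  assumes "schauder_frame x f"
  shows "norm (\<Sum>i=m..n. blinfun_apply (f i) v *\<^sub>R x i) \<le> projection_const x f * norm v"
proof -
  let ?S = "\<lambda>(m, n) v. \<Sum>i=m..n. blinfun_apply (f i) v *\<^sub>R x i"
  let ?A = "{norm (?S (m, n) v) | v m n. norm v \<le> 1 \<and> m \<le> n}"
  have lin: "bounded_linear (?S p)" for p
    by (cases p) (auto intro!: bounded_linear_sum bounded_linear_scaleR_const blinfun.bounded_linear_right)
  have "\<exists>B. \<forall>p. norm (?S p v) \<le> B" for v
    using assms summable_segments_bounded[of "\<lambda>i. blinfun_apply (f i) v *\<^sub>R x i"]
    unfolding schauder_frame_def by (auto simp: sums_iff)
  then obtain C where C: "\<And>p v. norm (?S p v) \<le> C * norm v"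
    using uniform_boundedness[of ?S, OF lin] by blast
  have bdd: "bdd_above ?A"
  proof (rule bdd_aboveI)
    fix r assume "r \<in> ?A"
    then obtain v m n where v: "r = norm (?S (m, n) v)" "norm v \<le> 1" by blast
    then have "r \<le> C * norm v" using C[of "(m, n)" v] by simp
    also have "\<dots> \<le> \<bar>C\<bar> * 1" using v by (intro mult_mono) auto
    finally show "r \<le> \<bar>C\<bar>" by simp
  qed
  have unit: "norm (?S (m, n) v) \<le> projection_const x f" if "norm v \<le> 1" "m \<le> n" for v m n
    unfolding projection_const_def using that bdd by (intro cSup_upper) auto
  \<comment> \<open>Lying above a norm, the supremum is nonnegative. This settles the empty segments
    \<open>n < m\<close>, over which it does not range.\<close>
  have K0: "projection_const x f \<ge> 0"
    using unit[of 0 0 0] by (auto intro: order_trans)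
  show ?thesis
  proof (cases "v = 0 \<or> n < m")
    case True
    then show ?thesis using K0 by auto
  next
    case False
    then have "norm (?S (m, n) ((1 / norm v) *\<^sub>R v)) \<le> projection_const x f"
      by (intro unit) auto
    then have "norm (?S (m, n) v) / norm v \<le> projection_const x f"
      using False linear_scale[OF bounded_linear.linear[OF lin], of "(m,n)" "1 / norm v" v] by simp
    then show ?thesis using False by (simp add: field_simps)
  qed
qed

text \<open>The initial segments of the expansion of \<open>x 0\<close> converge to
  \<open>x 0\<close>, so the segment bound passes to the limit. Positivity of the constant is what
  later turns \<open>lam < 1 / K\<close> into \<open>lam * K < 1\<close>.\<close>

lemma projection_const_ge_1:
  assumes "schauder_frame x f" "x 0 \<noteq> 0"
  shows "1 \<le> projection_const x f"
proof -
  have "(\<lambda>n. \<Sum>i=0..n. blinfun_apply (f i) (x 0) *\<^sub>R x i) \<longlonglongrightarrow> x 0"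
    using assms(1) by (simp add: schauder_frame_def sums_def_le atLeast0AtMost)
  then have "norm (x 0) \<le> projection_const x f * norm (x 0)"
    by (rule LIMSEQ_le_const2[OF tendsto_norm]) (use schauder_frame_segment_bound[OF assms(1)] in auto)
  then show ?thesis using assms(2) by simp
qed

section \<open>Inverting a small perturbation of the identity\<close>

text \<open>For fixed \<open>v\<close> the map sending \<open>w\<close> to \<open>v - R w\<close> is
  a contraction, and its fixed point is \<open>S v\<close>. Uniqueness of the fixed point makes
  \<open>S\<close> linear.\<close>

lemma perturbed_identity_right_inverse:
  fixes R :: "'a::banach \<Rightarrow> 'a"
  assumes "bounded_linear R" and R: "\<And>v. norm (R v) \<le> c * norm v" and c: "0 \<le> c" "c < 1"
  obtains S where "bounded_linear S" "\<And>v. S v + R (S v) = v"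
    "\<And>v. norm (S v) \<le> norm v / (1 - c)"
proof -
  interpret R: bounded_linear R by fact
  have ex1: "\<exists>!w. v - R w = w" for v
  proof (rule banach_fix_type[OF c], intro allI)
    fix a b
    show "dist (v - R a) (v - R b) \<le> c * dist a b"
      using R[of "b - a"] by (simp add: dist_norm R.diff norm_minus_commute)
  qed
  define S where "S v = (THE w. v - R w = w)" for v
  have S: "v - R (S v) = S v" for v
    unfolding S_def by (rule theI'[OF ex1])
  have uniq: "S v = w" if "v - R w = w" for v w
    using ex1[of v] S[of v] that by blast
  have bound: "norm (S v) \<le> norm v / (1 - c)" for v
  proof -
    \<comment> \<open>The last term is at most \<open>c * norm (S v)\<close> and is absorbed on the
      left because \<open>c < 1\<close>.\<close>
    have "norm (S v) \<le> norm v + norm (R (S v))"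
      by (metis S norm_triangle_ineq4)
    then show ?thesis using R[of "S v"] c by (simp add: field_simps)
  qed
  have "bounded_linear S"
  proof (rule bounded_linear_intro)
    show "S (v + w) = S v + S w" for v w
      using S[of v] S[of w] by (intro uniq) (simp add: R.add algebra_simps)
    show "S (r *\<^sub>R v) = r *\<^sub>R S v" for r v
      using arg_cong[OF S[of v], of "scaleR r"] by (intro uniq) (simp add: R.scaleR algebra_simps)
    show "norm (S v) \<le> norm v * (1 / (1 - c))" for v
      using bound[of v] by simp
  qed
  moreover have "S v + R (S v) = v" for v using S[of v] by (simp add: algebra_simps)
  ultimately show ?thesis using that bound by blast
qed

section \<open>Segment values of combinations of the minimal basis\<close>

lemma unit_vec_in_c00: "unit_vec n \<in> c00"
  by (auto simp: c00_def unit_vec_def)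

lemma e_Min_in_Z_Min: "e_Min x n \<in> Z_Min x"
  unfolding e_Min_def Z_Min_def by (simp add: closure_subset[THEN subsetD] unit_vec_in_c00)

lemma apply_e_Min: "apply_bcontfun (e_Min x i) (m, n) = (if i \<in> {m..n} then x i else 0)"
  unfolding e_Min_def apply_min_embed[OF unit_vec_in_c00]
  by (simp add: unit_vec_def if_distrib[of "\<lambda>r. r *\<^sub>R _"] cong: if_cong)

lemma bounded_linear_apply_bcontfun: "bounded_linear (\<lambda>w. apply_bcontfun w p)"
  by (rule bounded_linear_intro[where K = 1]) (auto simp: norm_bounded)

lemma apply_sum_e_Min:
  assumes "finite A"
  shows "apply_bcontfun (\<Sum>i\<in>A. c i *\<^sub>R e_Min x i) (m, n) = (\<Sum>i\<in>A \<inter> {m..n}. c i *\<^sub>R x i)"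
proof -
  have "apply_bcontfun (\<Sum>i\<in>A. c i *\<^sub>R e_Min x i) (m, n)
      = (\<Sum>i\<in>A. c i *\<^sub>R (if i \<in> {m..n} then x i else 0))"
    by (simp add: linear_sum[OF bounded_linear.linear[OF bounded_linear_apply_bcontfun]] apply_e_Min
        del: atLeastAtMost_iff)
  also have "\<dots> = (\<Sum>i\<in>A \<inter> {m..n}. c i *\<^sub>R x i)"
    using assms by (simp add: sum.inter_restrict if_distrib[of "scaleR _"] cong: if_cong)
  finally show ?thesis .
qed

lemma norm_sum_le_norm_sum_e_Min:
  "norm (\<Sum>i=m..<n. c i *\<^sub>R x i) \<le> norm (\<Sum>i=m..<n. c i *\<^sub>R e_Min x i)"
  using norm_bounded[of "\<Sum>i=m..<n. c i *\<^sub>R e_Min x i" "(m, n)"]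
  by (simp add: apply_sum_e_Min Int_absorb2 subset_eq)

text \<open>The one-point segment \<open>(j, j)\<close> isolates the term with index
  \<open>j\<close>.\<close>

lemma norm_term_le_norm_sum_e_Min:
  assumes "j \<in> {m..<n}"
  shows "\<bar>c j\<bar> * norm (x j) \<le> norm (\<Sum>i=m..<n. c i *\<^sub>R e_Min x i)"
  using norm_bounded[of "\<Sum>i=m..<n. c i *\<^sub>R e_Min x i" "(j, j)"] assms
  by (simp add: apply_sum_e_Min)

text \<open>Cutting \<open>{m..<n}\<close> with a segment leaves a segment that starts at
  \<open>m\<close> or later. Hence control of the tails beyond \<open>m\<close> suffices, as a
  Cauchy argument requires.\<close>

lemma norm_sum_e_Min_le:
  assumes "\<And>p q. m \<le> p \<Longrightarrow> norm (\<Sum>i=p..q. c i *\<^sub>R x i) \<le> B"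
  shows "norm (\<Sum>i=m..<n. c i *\<^sub>R e_Min x i) \<le> B"
proof (rule norm_bound, clarify)
  fix p q
  have "0 \<le> B" using assms[of "m" 0] norm_ge_zero order_trans by blast
  show "norm (apply_bcontfun (\<Sum>i=m..<n. c i *\<^sub>R e_Min x i) (p, q)) \<le> B"
  proof (cases n)
    case 0
    then show ?thesis using \<open>0 \<le> B\<close> by simp
  next
    case (Suc k)
    then have "{m..<n} \<inter> {p..q} = {max m p..min k q}" by auto
    then show ?thesis using assms by (simp add: apply_sum_e_Min)
  qed
qed

text \<open>Evaluation at a segment is continuous, and the partial sums evaluated there are constant
  once \<open>N\<close> exceeds \<open>n\<close>.\<close>

lemma apply_sums_e_Min:
  assumes "(\<lambda>i. c i *\<^sub>R e_Min x i) sums w"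
  shows "apply_bcontfun w (m, n) = (\<Sum>i=m..n. c i *\<^sub>R x i)"
proof (rule LIMSEQ_unique)
  show "(\<lambda>N. apply_bcontfun (\<Sum>i<N. c i *\<^sub>R e_Min x i) (m, n)) \<longlonglongrightarrow> apply_bcontfun w (m, n)"
    using assms unfolding sums_def by (rule bounded_linear.tendsto[OF bounded_linear_apply_bcontfun])
  have "apply_bcontfun (\<Sum>i<N. c i *\<^sub>R e_Min x i) (m, n) = (\<Sum>i=m..n. c i *\<^sub>R x i)" if "N \<ge> Suc n" for N
  proof -
    have "{..<N} \<inter> {m..n} = {m..n}" using that by auto
    then show ?thesis by (simp add: apply_sum_e_Min)
  qed
  then show "(\<lambda>N. apply_bcontfun (\<Sum>i<N. c i *\<^sub>R e_Min x i) (m, n)) \<longlonglongrightarrow> (\<Sum>i=m..n. c i *\<^sub>R x i)"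
    by (intro tendsto_eventually eventually_sequentiallyI)
qed

section \<open>The minimal basis is a Schauder basis\<close>

text \<open>The line through \<open>a\<close> is closed: multiplying \<open>a\<close> by scalars
  stretches distances by \<open>norm a\<close>, so the scalars \<open>d k\<close> are Cauchy as
  well.\<close>

lemma limit_of_multiples:
  fixes a :: "'a::real_normed_vector"
  assumes "(\<lambda>k. d k *\<^sub>R a) \<longlonglongrightarrow> b" "a \<noteq> 0"
  shows "\<exists>c. b = c *\<^sub>R a"
proof -
  have "Cauchy d"
  proof (rule metric_CauchyI)
    fix e :: real assume "e > 0"
    then obtain M where M: "\<forall>m\<ge>M. \<forall>n\<ge>M. dist (d m *\<^sub>R a) (d n *\<^sub>R a) < e * norm a"
      using LIMSEQ_imp_Cauchy[OF assms(1)] assms(2) unfolding Cauchy_def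
      by (meson mult_pos_pos zero_less_norm_iff)
    have "dist (d m *\<^sub>R a) (d n *\<^sub>R a) = dist (d m) (d n) * norm a" for m n
      by (simp add: dist_norm flip: scaleR_diff_left)
    then show "\<exists>M. \<forall>m\<ge>M. \<forall>n\<ge>M. dist (d m) (d n) < e"
      using M assms(2) by auto
  qed
  then obtain c where "d \<longlonglongrightarrow> c" using convergent_eq_Cauchy by blast
  then have "(\<lambda>k. d k *\<^sub>R a) \<longlonglongrightarrow> c *\<^sub>R a" by (intro tendsto_intros)
  then show ?thesis using LIMSEQ_unique assms(1) by blast
qed

text \<open>The coefficients are read off the diagonal: \<open>w\<close> at \<open>(i, i)\<close> is
  a limit of multiples of \<open>x i\<close>, hence itself such a multiple.\<close>

lemma Z_Min_expansion:
  assumes x: "\<And>n. x n \<noteq> 0" and "w \<in> Z_Min x"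
  shows "\<exists>c. (\<lambda>i. c i *\<^sub>R e_Min x i) sums w"
proof -
  obtain u where u: "\<And>k. u k \<in> min_embed x ` c00" "u \<longlonglongrightarrow> w"
    using assms(2) unfolding Z_Min_def closure_sequential by blast
  then obtain d where d: "\<And>k. d k \<in> c00" "\<And>k. u k = min_embed x (d k)"
    unfolding image_iff by metis
  have lim: "(\<lambda>k. \<Sum>i=m..n. d k i *\<^sub>R x i) \<longlonglongrightarrow> apply_bcontfun w (m, n)" for m n
    using bounded_linear.tendsto[OF bounded_linear_apply_bcontfun u(2), of "(m, n)"]
    by (simp add: d apply_min_embed)
  have "\<exists>c. apply_bcontfun w (i, i) = c *\<^sub>R x i" for i
    using lim[of i i] x by (intro limit_of_multiples[where d = "\<lambda>k. d k i"]) auto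
  then obtain c where c: "\<And>i. apply_bcontfun w (i, i) = c i *\<^sub>R x i" by metis
  \<comment> \<open>The remaining values are determined by the diagonal, since the segment sums of
    the approximants converge term by term.\<close>
  have w: "apply_bcontfun w (m, n) = (\<Sum>i=m..n. c i *\<^sub>R x i)" for m n
  proof (rule LIMSEQ_unique[OF lim])
    show "(\<lambda>k. \<Sum>i=m..n. d k i *\<^sub>R x i) \<longlonglongrightarrow> (\<Sum>i=m..n. c i *\<^sub>R x i)"
      using lim[of i i for i] by (intro tendsto_sum) (simp add: c)
  qed
  \<comment> \<open>The tail of \<open>w\<close> beyond \<open>N\<close> has the values \<open>w (max m N, n)\<close>, and these vanish for \<open>u k\<close> in place of \<open>w\<close>
    once \<open>N\<close> exceeds the support of \<open>d k\<close>.\<close>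
  have "(\<lambda>N. \<Sum>i<N. c i *\<^sub>R e_Min x i) \<longlonglongrightarrow> w"
  proof (rule metric_LIMSEQ_I)
    fix e :: real assume "e > 0"
    then obtain k where k: "dist (u k) w < e"
      using u(2) by (metis metric_LIMSEQ_D order_refl)
    obtain N0 where N0: "\<And>i. i \<ge> N0 \<Longrightarrow> d k i = 0"
      using d(1)[of k] unfolding c00_def
      by (metis (mono_tags, lifting) finite_nat_set_iff_bounded linorder_not_less mem_Collect_eq)
    have "dist (\<Sum>i<N. c i *\<^sub>R e_Min x i) w < e" if "N \<ge> N0" for N
    proof -
      have "norm (w - (\<Sum>i<N. c i *\<^sub>R e_Min x i)) \<le> norm (w - u k)"
      proof (rule norm_bound, clarify)
        fix m n
        have "(\<Sum>i=m..n. c i *\<^sub>R x i)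
            = (\<Sum>i\<in>{m..n} \<inter> {..<N}. c i *\<^sub>R x i) + (\<Sum>i\<in>{m..n} - {..<N}. c i *\<^sub>R x i)"
          by (intro sum.Int_Diff) simp
        moreover have "{m..n} - {..<N} = {max m N..n}" by auto
        moreover have "(\<Sum>i=max m N..n. d k i *\<^sub>R x i) = 0"
          using N0 that by (intro sum.neutral) auto
        ultimately have "apply_bcontfun (w - (\<Sum>i<N. c i *\<^sub>R e_Min x i)) (m, n)
            = apply_bcontfun (w - u k) (max m N, n)"
          by (simp add: w apply_sum_e_Min d apply_min_embed Int_commute)
        then show "norm (apply_bcontfun (w - (\<Sum>i<N. c i *\<^sub>R e_Min x i)) (m, n)) \<le> norm (w - u k)"
          by (simp only: norm_bounded)
      qed
      then show ?thesis using k by (simp add: dist_norm norm_minus_commute)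
    qed
    then show "\<exists>N0. \<forall>N\<ge>N0. dist (\<Sum>i<N. c i *\<^sub>R e_Min x i) w < e" by blast
  qed
  then show ?thesis unfolding sums_def by blast
qed

text \<open>Coefficients are unique because evaluation at \<open>(i, i)\<close> recovers
  \<open>c i *\<^sub>R x i\<close>, and \<open>x i\<close> is nonzero.\<close>

lemma schauder_basis_on_Z_Min:
  assumes "\<And>n. x n \<noteq> 0"
  shows "schauder_basis_on (Z_Min x) (e_Min x)"
proof -
  have uniq: "c = c'"
    if "(\<lambda>i. c i *\<^sub>R e_Min x i) sums w" "(\<lambda>i. c' i *\<^sub>R e_Min x i) sums w" for c c' w
  proof
    fix i
    have "c i *\<^sub>R x i = apply_bcontfun w (i, i)"
      using apply_sums_e_Min[OF that(1)] by simp
    also have "\<dots> = c' i *\<^sub>R x i"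
      using apply_sums_e_Min[OF that(2)] by simp
    finally show "c i = c' i" using assms[of i] by simp
  qed
  have "\<exists>!c. (\<lambda>i. c i *\<^sub>R e_Min x i) sums w" if "w \<in> Z_Min x" for w
    by (rule ex_ex1I[OF Z_Min_expansion[OF assms that] uniq])
  then show ?thesis
    unfolding schauder_basis_on_def
    by (simp add: subspace_Z_Min complete_Z_Min e_Min_in_Z_Min image_subset_iff)
qed

section \<open>Operators between the minimal space and the given space\<close>

text \<open>A series is Cauchy exactly when its late segments are uniformly small, and that is
  smallness of the tails in the supremum norm over segments. Convergence thus lifts to
  \<open>Z_Min x\<close>.\<close>

lemma summable_e_Min:
  fixes x :: "nat \<Rightarrow> 'a::banach"
  assumes "summable (\<lambda>i. c i *\<^sub>R x i)"
  shows "\<exists>w\<in>Z_Min x. (\<lambda>i. c i *\<^sub>R e_Min x i) sums w"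
proof -
  let ?h = "\<lambda>N. \<Sum>i<N. c i *\<^sub>R e_Min x i"
  have "?h N \<in> Z_Min x" for N
    using subspace_Z_Min e_Min_in_Z_Min by (intro subspace_sum subspace_scale)
  moreover have "Cauchy ?h"
  proof (rule CauchyI')
    fix e :: real assume "e > 0"
    \<comment> \<open>Half of \<open>e\<close> is used because \<open>norm_sum_e_Min_le\<close>
      gives only a weak inequality.\<close>
    then obtain M where M: "\<And>m n. m \<ge> M \<Longrightarrow> norm (\<Sum>i=m..<n. c i *\<^sub>R x i) < e / 2"
      using assms unfolding summable_Cauchy by (meson half_gt_zero)
    have "dist (?h m) (?h n) < e" if "m \<ge> M" "n > m" for m n
    proof -
      have "norm (\<Sum>i=p..q. c i *\<^sub>R x i) \<le> e / 2" if "m \<le> p" for p q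
        using M[of p "Suc q"] that \<open>m \<ge> M\<close> by (simp add: atLeastLessThanSuc_atLeastAtMost)
      then have "norm (\<Sum>i=m..<n. c i *\<^sub>R e_Min x i) \<le> e / 2"
        by (rule norm_sum_e_Min_le)
      moreover have "?h n - ?h m = (\<Sum>i=m..<n. c i *\<^sub>R e_Min x i)"
        using that sum_diff_nat_ivl[of 0 m n] by (simp add: atLeast0LessThan)
      ultimately show ?thesis using \<open>e > 0\<close> norm_minus_commute[of "?h m" "?h n"] by (simp add: dist_norm)
    qed
    then show "\<exists>M. \<forall>m\<ge>M. \<forall>n>m. dist (?h m) (?h n) < e" by blast
  qed
  ultimately show ?thesis
    using complete_Z_Min[of x] unfolding complete_def sums_def
    by (elim allE[of _ ?h]) blast
qed

text \<open>An estimate on finite segments carries the Cauchy property from the basis expansion to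
  the series in \<open>y\<close>, and bounds the limit.\<close>

lemma synthesis_operator_exists:
  fixes y :: "nat \<Rightarrow> 'a::banach"
  assumes basis: "schauder_basis_on Z z"
    and est: "\<And>c m n. norm (\<Sum>i=m..<n. c i *\<^sub>R y i) \<le> B * norm (\<Sum>i=m..<n. c i *\<^sub>R z i)"
  obtains U where "synthesis_operator Z z y U" "\<And>w. w \<in> Z \<Longrightarrow> norm (U w) \<le> B * norm w"
proof -
  have Z: "subspace Z" "complete Z" "\<And>w. w \<in> Z \<Longrightarrow> \<exists>!c. (\<lambda>n. c n *\<^sub>R z n) sums w"
    using basis by (auto simp: schauder_basis_on_def)
  define coef where "coef w = (THE c. (\<lambda>n. c n *\<^sub>R z n) sums w)" for w
  have coef: "(\<lambda>n. coef w n *\<^sub>R z n) sums w" if "w \<in> Z" for w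
    unfolding coef_def by (rule theI'[OF Z(3)[OF that]])
  have coef_eq: "c = coef w" if "w \<in> Z" "(\<lambda>n. c n *\<^sub>R z n) sums w" for c w
    using Z(3)[OF that(1)] coef[OF that(1)] that(2) by blast
  define U where "U w = (\<Sum>n. coef w n *\<^sub>R y n)" for w
  have summ: "summable (\<lambda>n. coef w n *\<^sub>R y n)" if w: "w \<in> Z" for w
    unfolding summable_Cauchy
  proof (intro allI impI)
    fix e :: real assume e: "e > 0"
    let ?s = "\<lambda>n. \<Sum>i<n. coef w i *\<^sub>R z i"
    have "Cauchy ?s" using coef[OF w] unfolding sums_def by (rule LIMSEQ_imp_Cauchy)
    \<comment> \<open>The sign of \<open>B\<close> is unknown and \<open>B\<close> may be 0, whereas
      \<open>\<bar>B\<bar> + 1\<close> is positive and dominates \<open>B\<close>.\<close>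
    then obtain M where M: "\<And>m n. m \<ge> M \<Longrightarrow> n \<ge> M \<Longrightarrow> norm (?s m - ?s n) < e / (\<bar>B\<bar> + 1)"
      using CauchyD[of ?s "e / (\<bar>B\<bar> + 1)"] e by auto
    have "norm (\<Sum>i=m..<n. coef w i *\<^sub>R y i) < e" if "m \<ge> M" for m n
    proof (cases "m \<le> n")
      case True
      then have "?s n - ?s m = (\<Sum>i=m..<n. coef w i *\<^sub>R z i)"
        using sum_diff_nat_ivl[of 0 m n] by (simp add: atLeast0LessThan)
      then have lt: "norm (\<Sum>i=m..<n. coef w i *\<^sub>R z i) < e / (\<bar>B\<bar> + 1)"
        using M[of n m] that True by simp
      have "norm (\<Sum>i=m..<n. coef w i *\<^sub>R y i) \<le> B * norm (\<Sum>i=m..<n. coef w i *\<^sub>R z i)"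
        by (rule est)
      also have "\<dots> \<le> (\<bar>B\<bar> + 1) * norm (\<Sum>i=m..<n. coef w i *\<^sub>R z i)"
        by (intro mult_right_mono) auto
      also have "\<dots> < e" using lt by (simp add: field_simps)
      finally show ?thesis .
    qed (use e in simp)
    then show "\<exists>N. \<forall>m\<ge>N. \<forall>n. norm (\<Sum>i=m..<n. coef w i *\<^sub>R y i) < e" by blast
  qed
  then have U: "(\<lambda>n. coef w n *\<^sub>R y n) sums U w" if "w \<in> Z" for w
    using that unfolding U_def by (intro summable_sums)
  have syn: "(\<lambda>n. c n *\<^sub>R y n) sums U w" if "w \<in> Z" "(\<lambda>n. c n *\<^sub>R z n) sums w" for c w
    using U[OF that(1)] coef_eq[OF that] by simp
  have bound: "norm (U w) \<le> B * norm w" if "w \<in> Z" for w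
  proof (rule LIMSEQ_le)
    show "(\<lambda>n. norm (\<Sum>i<n. coef w i *\<^sub>R y i)) \<longlonglongrightarrow> norm (U w)"
      using U[OF that] unfolding sums_def by (rule tendsto_norm)
    show "(\<lambda>n. B * norm (\<Sum>i<n. coef w i *\<^sub>R z i)) \<longlonglongrightarrow> B * norm w"
      using coef[OF that] unfolding sums_def by (intro tendsto_intros)
    show "\<exists>N. \<forall>n\<ge>N. norm (\<Sum>i<n. coef w i *\<^sub>R y i) \<le> B * norm (\<Sum>i<n. coef w i *\<^sub>R z i)"
      using est[where m = 0] by (auto simp: atLeast0LessThan)
  qed
  have "U (v + w) = U v + U w" if "v \<in> Z" "w \<in> Z" for v w
  proof (rule sums_unique2)
    \<comment> \<open>The added coefficients expand \<open>v + w\<close> in the basis, so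
      \<open>syn\<close> applies to them.\<close>
    show "(\<lambda>n. (coef v n + coef w n) *\<^sub>R y n) sums U (v + w)"
      using sums_add[OF coef coef] that Z(1)
      by (intro syn) (auto simp: scaleR_add_left subspace_add)
    show "(\<lambda>n. (coef v n + coef w n) *\<^sub>R y n) sums (U v + U w)"
      using sums_add[OF U U] that by (simp add: scaleR_add_left)
  qed
  moreover have "U (r *\<^sub>R w) = r *\<^sub>R U w" if "w \<in> Z" for r w
  proof (rule sums_unique2)
    show "(\<lambda>n. (r * coef w n) *\<^sub>R y n) sums U (r *\<^sub>R w)"
      using sums_scaleR_right[OF coef] that Z(1)
      by (intro syn) (auto simp: subspace_scale simp flip: scaleR_scaleR)
    show "(\<lambda>n. (r * coef w n) *\<^sub>R y n) sums (r *\<^sub>R U w)"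
      using sums_scaleR_right[OF U] that by (simp flip: scaleR_scaleR)
  qed
  ultimately have "synthesis_operator Z z y U"
    unfolding synthesis_operator_def bounded_linear_on_def using syn bound by blast
  then show ?thesis using that bound by blast
qed

text \<open>Replacing \<open>y i\<close> by \<open>x i\<close> costs at most
  \<open>\<bar>c i\<bar> * norm (x i - y i)\<close> per index. Each
  \<open>\<bar>c i\<bar> * norm (x i)\<close> is bounded by the minimal norm, so the total cost is
  at most \<open>lam\<close> times that norm.\<close>

lemma perturbation_bound_e_Min:
  fixes x y :: "nat \<Rightarrow> 'a::banach"
  assumes x: "\<And>n. x n \<noteq> 0"
    and lam: "(\<lambda>n. norm (x n - y n) / norm (x n)) sums lam"
  shows "norm (\<Sum>i=m..<n. c i *\<^sub>R y i) \<le> (1 + lam) * norm (\<Sum>i=m..<n. c i *\<^sub>R e_Min x i)"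
proof -
  let ?N = "norm (\<Sum>i=m..<n. c i *\<^sub>R e_Min x i)"
  have "norm (\<Sum>i=m..<n. c i *\<^sub>R (x i - y i)) \<le> (\<Sum>i=m..<n. norm (c i *\<^sub>R (x i - y i)))"
    by (rule norm_sum)
  also have "\<dots> \<le> (\<Sum>i=m..<n. norm (x i - y i) / norm (x i) * ?N)"
  proof (rule sum_mono)
    fix i assume "i \<in> {m..<n}"
    then have "\<bar>c i\<bar> * norm (x i) \<le> ?N" by (rule norm_term_le_norm_sum_e_Min)
    then have "norm (x i - y i) / norm (x i) * (\<bar>c i\<bar> * norm (x i)) \<le> norm (x i - y i) / norm (x i) * ?N"
      by (intro mult_left_mono) auto
    then show "norm (c i *\<^sub>R (x i - y i)) \<le> norm (x i - y i) / norm (x i) * ?N"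
      using x by (simp add: mult.commute)
  qed
  also have "\<dots> = (\<Sum>i=m..<n. norm (x i - y i) / norm (x i)) * ?N"
    by (simp add: sum_distrib_right)
  also have "\<dots> \<le> lam * ?N"
    using lam by (intro mult_right_mono) (auto simp: sums_iff intro!: sum_le_suminf)
  finally have "norm (\<Sum>i=m..<n. c i *\<^sub>R (x i - y i)) \<le> lam * ?N" .
  moreover have "(\<Sum>i=m..<n. c i *\<^sub>R y i) = (\<Sum>i=m..<n. c i *\<^sub>R x i) - (\<Sum>i=m..<n. c i *\<^sub>R (x i - y i))"
    by (simp add: scaleR_diff_right sum_subtractf)
  moreover have "norm (\<Sum>i=m..<n. c i *\<^sub>R x i) \<le> ?N" by (rule norm_sum_le_norm_sum_e_Min)
  ultimately show ?thesis
    using norm_triangle_ineq4[of "\<Sum>i=m..<n. c i *\<^sub>R x i" "\<Sum>i=m..<n. c i *\<^sub>R (x i - y i)"]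
    unfolding distrib_right mult_1 by (smt (verit))
qed

text \<open>The values of \<open>V v\<close> are the segment sums of the given series, so a uniform
  bound on them is a bound on the supremum norm of \<open>V v\<close>.\<close>

lemma analysis_operator_e_Min:
  fixes x :: "nat \<Rightarrow> 'a::banach" and h :: "nat \<Rightarrow> 'a \<Rightarrow>\<^sub>L real"
  assumes summ: "\<And>v. summable (\<lambda>i. blinfun_apply (h i) v *\<^sub>R x i)"
    and bound: "\<And>p q v. norm (\<Sum>i=p..q. blinfun_apply (h i) v *\<^sub>R x i) \<le> B * norm v"
  obtains V where "analysis_operator (Z_Min x) (e_Min x) h V" "\<And>v. norm (V v) \<le> B * norm v"
proof -
  define V where "V v = (\<Sum>i. blinfun_apply (h i) v *\<^sub>R e_Min x i)" for v
  have V: "(\<lambda>i. blinfun_apply (h i) v *\<^sub>R e_Min x i) sums V v" "V v \<in> Z_Min x" for v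
    using summable_e_Min[OF summ, of v] unfolding V_def by (auto simp: sums_iff)
  have le: "norm (V v) \<le> B * norm v" for v
  proof (rule norm_bound, clarify)
    show "norm (apply_bcontfun (V v) (p, q)) \<le> B * norm v" for p q
      unfolding apply_sums_e_Min[OF V(1)] by (rule bound)
  qed
  have "bounded_linear V"
  proof (rule bounded_linear_intro)
    show "V (v + w) = V v + V w" for v w
      using sums_add[OF V(1)[of v] V(1)[of w]]
      by (intro sums_unique2[OF V(1)]) (simp add: blinfun.add_right scaleR_add_left)
    show "V (r *\<^sub>R v) = r *\<^sub>R V v" for r v
      using sums_scaleR_right[OF V(1)[of v], of r]
      by (intro sums_unique2[OF V(1)]) (simp add: blinfun.scaleR_right)
    show "norm (V v) \<le> norm v * B" for v
      using le[of v] by (simp add: mult.commute)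
  qed
  then have "analysis_operator (Z_Min x) (e_Min x) h V"
    unfolding analysis_operator_def using V by blast
  then show ?thesis using that le by blast
qed

section \<open>Unconditional convergence and the perturbed frame\<close>

lemma unconditionally_convergent_add_absolutely:
  fixes a b :: "nat \<Rightarrow> 'a::banach"
  assumes "unconditionally_convergent a" "summable (\<lambda>n. norm (b n))"
  shows "unconditionally_convergent (\<lambda>n. a n + b n)"
  unfolding unconditionally_convergent_def
proof (intro allI impI)
  fix p :: "nat \<Rightarrow> nat" assume "bij p"
  then have "summable ((\<lambda>n. norm (b n)) \<circ> p)"
    using summable_reindex[OF assms(2) bij_is_inj] by simp
  then have "summable (\<lambda>n. b (p n))" by (auto simp: o_def intro: summable_norm_cancel)
  then show "summable (\<lambda>n. a (p n) + b (p n))"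
    using assms(1) \<open>bij p\<close> by (intro summable_add) (auto simp: unconditionally_convergent_def)
qed

theorem theorem3p3:
  fixes x y :: "nat \<Rightarrow> 'a::banach"
    and f :: "nat \<Rightarrow> 'a \<Rightarrow>\<^sub>L real"
    and K lam :: real
  assumes "schauder_frame x f"
    and "\<And>n. x n \<noteq> 0"
    and "K = projection_const x f"
    and "(\<lambda>n. norm (x n - y n) / norm (x n)) sums lam"
    and "lam < 1 / K"
  shows "\<exists>g :: nat \<Rightarrow> 'a \<Rightarrow>\<^sub>L real.
    schauder_frame y g \<and>
    associated_sequence_space (Z_Min x) (e_Min x) y g \<and>
    (\<exists>U. synthesis_operator (Z_Min x) (e_Min x) y U \<and> onorm_on (Z_Min x) U \<le> 1 + lam) \<and>
    (\<exists>V. analysis_operator (Z_Min x) (e_Min x) g V \<and>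
      (\<forall>v. 1 / (1 + lam) * norm v \<le> norm (V v) \<and>
           norm (V v) \<le> K / (1 - lam * K) * norm v)) \<and>
    (unconditional_schauder_frame x f \<longrightarrow> unconditional_schauder_frame y g)"
proof -
  have K: "norm (\<Sum>i=m..n. blinfun_apply (f i) v *\<^sub>R x i) \<le> K * norm v" for m n v
    using schauder_frame_segment_bound[OF assms(1)] assms(3) by simp
  have "1 \<le> K" using projection_const_ge_1[OF assms(1,2)] assms(3) by simp
  then have lamK: "lam * K < 1" using assms(5) by (simp add: field_simps)
  have "0 \<le> lam" using assms(4) by (auto simp: sums_iff intro: suminf_nonneg)
  define b where "b v = (\<lambda>n. blinfun_apply (f n) v *\<^sub>R (y n - x n))" for v
  have b_le: "norm (b v n) \<le> norm (x n - y n) / norm (x n) * (K * norm v)" for v n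
  proof -
    \<comment> \<open>The segment bound at the one-term segment \<open>m = n\<close> controls
      \<open>\<bar>blinfun_apply (f n) v\<bar> * norm (x n)\<close>.\<close>
    have "norm (x n - y n) / norm (x n) * (\<bar>blinfun_apply (f n) v\<bar> * norm (x n))
        \<le> norm (x n - y n) / norm (x n) * (K * norm v)"
      using K[where m = n and n = n] by (intro mult_left_mono) auto
    then show ?thesis
      using assms(2)[of n] by (simp add: b_def norm_minus_commute mult.commute)
  qed
  have major: "(\<lambda>n. norm (x n - y n) / norm (x n) * (K * norm v)) sums (lam * (K * norm v))" for v :: 'a
    by (rule sums_mult2[OF assms(4)])
  have b_abs: "summable (\<lambda>n. norm (b v n))" for v
    using b_le by (intro summable_comparison_test'[OF sums_summable[OF major[of v]], of 0]) simp
  define R where "R v = (\<Sum>n. b v n)" for v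
  have R: "b v sums R v" for v
    unfolding R_def using summable_norm_cancel[OF b_abs] by (rule summable_sums)
  have R_le: "norm (R v) \<le> lam * K * norm v" for v
  proof -
    have "norm (R v) \<le> (\<Sum>n. norm (b v n))"
      unfolding R_def by (rule summable_norm[OF b_abs])
    also have "\<dots> \<le> (\<Sum>n. norm (x n - y n) / norm (x n) * (K * norm v))"
      using b_le b_abs major by (intro suminf_le) (auto simp: sums_iff)
    also have "\<dots> = lam * K * norm v" using major[of v] by (simp add: sums_iff)
    finally show ?thesis .
  qed
  have "bounded_linear R"
  proof (rule bounded_linear_intro)
    show "R (v + w) = R v + R w" for v w
      using sums_add[OF R[of v] R[of w]]
      by (intro sums_unique2[OF R]) (simp add: b_def blinfun.add_right scaleR_add_left)
    show "R (r *\<^sub>R v) = r *\<^sub>R R v" for r v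
      using sums_scaleR_right[OF R[of v], of r]
      by (intro sums_unique2[OF R]) (simp add: b_def blinfun.scaleR_right)
    show "norm (R v) \<le> norm v * (lam * K)" for v
      using R_le[of v] by (simp add: mult.commute)
  qed
  then obtain S where S: "bounded_linear S" "\<And>v. S v + R (S v) = v"
    "\<And>v. norm (S v) \<le> norm v / (1 - lam * K)"
    using perturbed_identity_right_inverse[of R "lam * K"] R_le lamK \<open>0 \<le> lam\<close> \<open>1 \<le> K\<close> by auto
  define g where "g n = f n o\<^sub>L Blinfun S" for n
  have g: "blinfun_apply (g n) v = blinfun_apply (f n) (S v)" for n v
    by (simp add: g_def bounded_linear_Blinfun_apply[OF S(1)])
  have f: "(\<lambda>n. blinfun_apply (f n) v *\<^sub>R x n) sums v" for v
    using assms(1) by (simp add: schauder_frame_def)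
  have split: "blinfun_apply (g n) v *\<^sub>R y n = blinfun_apply (f n) (S v) *\<^sub>R x n + b (S v) n" for n v
    by (simp add: g b_def scaleR_diff_right)
  have frame: "schauder_frame y g"
    unfolding schauder_frame_def split using sums_add[OF f R] S(2) by metis
  note basis = schauder_basis_on_Z_Min[of x, OF assms(2)]
  obtain U where U: "synthesis_operator (Z_Min x) (e_Min x) y U"
    "\<And>w. w \<in> Z_Min x \<Longrightarrow> norm (U w) \<le> (1 + lam) * norm w"
    using synthesis_operator_exists[OF basis perturbation_bound_e_Min[OF assms(2,4)]] by blast
  have onorm: "onorm_on (Z_Min x) U \<le> 1 + lam"
    unfolding onorm_on_def
  proof (rule cSUP_least)
    show "Z_Min x \<noteq> {}" using e_Min_in_Z_Min by blast
    \<comment> \<open>At \<open>w = 0\<close> the quotient is \<open>0 / 0\<close>, which HOL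
      evaluates to 0.\<close>
    show "norm (U w) / norm w \<le> 1 + lam" if "w \<in> Z_Min x" for w
      using U(2)[OF that] \<open>0 \<le> lam\<close> by (cases "w = 0") (auto simp: field_simps)
  qed
  \<comment> \<open>These are segments of the expansion of \<open>S v\<close> in the original frame:
    \<open>K\<close> bounds them against \<open>norm (S v)\<close>, and the bound on
    \<open>S\<close> supplies the denominator.\<close>
  have "norm (\<Sum>i=p..q. blinfun_apply (g i) v *\<^sub>R x i) \<le> K / (1 - lam * K) * norm v" for p q v
  proof -
    have "K * norm (S v) \<le> K * (norm v / (1 - lam * K))"
      using S(3) \<open>1 \<le> K\<close> by (intro mult_left_mono) auto
    then show ?thesis unfolding g using K[where v = "S v"] by (auto intro: order_trans)
  qed
  moreover have "summable (\<lambda>i. blinfun_apply (g i) v *\<^sub>R x i)" for v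
    unfolding g using f by (rule sums_summable)
  ultimately obtain V where V: "analysis_operator (Z_Min x) (e_Min x) g V"
    "\<And>v. norm (V v) \<le> K / (1 - lam * K) * norm v"
    using analysis_operator_e_Min by blast
  \<comment> \<open>Synthesis with \<open>y\<close> applied to the coefficients of
    \<open>V v\<close> gives the frame series of \<open>v\<close>.\<close>
  have "U (V v) = v" for v
  proof (rule sums_unique2)
    show "(\<lambda>n. blinfun_apply (g n) v *\<^sub>R y n) sums U (V v)"
      using U(1) V(1) by (simp add: synthesis_operator_def analysis_operator_def image_subset_iff)
    show "(\<lambda>n. blinfun_apply (g n) v *\<^sub>R y n) sums v"
      using frame by (simp add: schauder_frame_def)
  qed
  then have "norm v \<le> (1 + lam) * norm (V v)" for v
    using U(2)[of "V v"] V(1) by (simp add: analysis_operator_def image_subset_iff)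
  then have lower: "1 / (1 + lam) * norm v \<le> norm (V v)" for v
    using \<open>0 \<le> lam\<close> by (simp add: field_simps)
  \<comment> \<open>By \<open>split\<close>, the new series at \<open>v\<close> is the old one at
    \<open>S v\<close> plus the absolutely convergent \<open>b (S v)\<close>.\<close>
  have "unconditional_schauder_frame y g" if "unconditional_schauder_frame x f"
    using that frame unfolding unconditional_schauder_frame_def split
    by (simp add: unconditionally_convergent_add_absolutely[OF _ b_abs])
  moreover have "associated_sequence_space (Z_Min x) (e_Min x) y g"
    unfolding associated_sequence_space_def using frame basis U(1) V(1) by (intro conjI exI)
  ultimately show ?thesis
    using frame U(1) onorm V lower by (intro exI[of _ g] conjI exI[of _ U] exI[of _ V] allI impI)
qed

end
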